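(* Let $(f_\ell)_{\ell\in\mathbb N}$ be an admissible sequence of weight functions (as defined in the context) and let $S\subseteq\mathbb N$ with complement $E=\mathbb N\setminus S$. Assume $1,2,3\in S$. Let $n\ge 3$ be an integer with $n\not\equiv 2\pmod 3$. Then for all sufficiently large $\ell$ (depending on $n$): $\Delta_{E,\ell}(n)>0$ if $n\equiv 0\pmod 3$, and $\Delta_{E,\ell}(n)<0$ if $n\equiv 1\pmod 3$.
   Context: $\mathbb N=\{1,2,3,\dots\}$. An admissible sequence of weight functions is a sequence $(f_\ell)_{\ell\in\mathbb N}$ of functions $f_\ell:\mathbb N\to\mathbb N$ with $f_\ell(1)=1$ for all $\ell$ and $f_1\equiv 1$, for which there exist real-valued functions $\Phi,\Psi$ on $\mathbb N$ such that: (1) $n^{\Phi(\ell)}\le f_\ell(n)\le n^{\Psi(\ell)}$ for all $\ell,n\in\mathbb N$; (2) there is a positive number $B$ independent of $\ell$ with $0\le\Psi(\ell)-\Phi(\ell)\le B$ for all $\ell$; (3) $\lim_{\ell\to\infty}\Phi(\ell)=\infty$. For $S\subseteq\mathbb N$ with $1\in S$ and $E=\mathbb N\setminus S$ (the exception set), the numbers $p_{E,\ell}(n)$ are defined by the formal power series identity $\sum_{n=0}^\infty p_{E,\ell}(n)q^n=\prod_{n\in S}(1-q^n)^{-f_\ell(n)}$, and $\Delta_{E,\ell}(n):=p_{E,\ell}(n)^2-p_{E,\ell}(n-1)\,p_{E,\ell}(n+1)$ for $n\ge1$. *)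

theory Defs
  imports "HOL-Analysis.Analysis"
begin

text \<open>
  Here the natural numbers start at 1. Functions on them are rendered as functions on
  \<^typ>\<open>nat\<close> whose values at 0 are unconstrained and irrelevant.
\<close>

definition admissible :: "(nat \<Rightarrow> nat \<Rightarrow> nat) \<Rightarrow> bool" where
  "admissible f \<longleftrightarrow>
     (\<forall>l\<ge>1. \<forall>n\<ge>1. f l n \<ge> 1) \<and>
     (\<forall>l\<ge>1. f l 1 = 1) \<and>
     (\<forall>n\<ge>1. f 1 n = 1) \<and>
     (\<exists>\<Phi> \<Psi> :: nat \<Rightarrow> real.
        (\<forall>l\<ge>1. \<forall>n\<ge>1. real n powr \<Phi> l \<le> real (f l n) \<and> real (f l n) \<le> real n powr \<Psi> l) \<and>
        (\<exists>B>0. \<forall>l\<ge>1. 0 \<le> \<Psi> l - \<Phi> l \<and> \<Psi> l - \<Phi> l \<le> B) \<and>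
        filterlim \<Phi> at_top sequentially)"

text \<open>
  The infinite product is taken in the library's topology on formal power series
  (coefficientwise stabilisation). Its convergence is \<open>has_prod_partition_gf\<close> below,
  so that \<^const>\<open>prodinf\<close> denotes the actual limit of the partial products.
\<close>

definition partition_gf :: "nat set \<Rightarrow> (nat \<Rightarrow> nat) \<Rightarrow> real fps" where
  "partition_gf E g =
     (\<Prod>k. if k \<in> {1..} - E then inverse ((1 - fps_X ^ k) ^ g k) else 1)"

definition p_exc :: "(nat \<Rightarrow> nat \<Rightarrow> nat) \<Rightarrow> nat set \<Rightarrow> nat \<Rightarrow> nat \<Rightarrow> real" where
  "p_exc f E l n = fps_nth (partition_gf E (f l)) n"

definition Delta :: "(nat \<Rightarrow> nat \<Rightarrow> nat) \<Rightarrow> nat set \<Rightarrow> nat \<Rightarrow> nat \<Rightarrow> real" where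
  "Delta f E l n = (p_exc f E l n)\<^sup>2 - p_exc f E l (n - 1) * p_exc f E l (n + 1)"

lemma partition_factor_nth:
  fixes E :: "nat set" and g :: "nat \<Rightarrow> nat"
  assumes "n < k \<or> n = 0"
  shows "fps_nth (if k \<in> {1..} - E then inverse ((1 - fps_X ^ k) ^ g k) else 1 :: real fps) n =
         fps_nth 1 n"
proof (cases "k \<in> {1..} - E")
  case True
  hence k: "k > 0" by auto
  define h :: "real fps" where "h = (1 - fps_X ^ k) ^ g k"
  have "fps_X ^ k dvd (1 - fps_X ^ k :: real fps) ^ m - 1" for m
  proof -
    have "(1 - fps_X ^ k :: real fps) - 1 dvd (1 - fps_X ^ k) ^ m - 1 ^ m"
      unfolding power_diff_sumr2 by simp
    thus ?thesis by simp
  qed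
  then obtain d where d: "h - 1 = fps_X ^ k * d"
    unfolding h_def by (auto elim: dvdE)
  have "fps_nth (h - 1) 0 = 0"
    using k unfolding d by (simp add: fps_X_power_mult_nth)
  hence h0: "fps_nth h 0 = 1" by simp
  hence "h * inverse h = 1" by (intro inverse_mult_eq_1') simp
  moreover have "fps_X ^ k * (d * inverse h) = h * inverse h - inverse h"
    by (simp only: d[symmetric] mult.assoc[symmetric] left_diff_distrib mult_1_left)
  ultimately have "inverse h = 1 - fps_X ^ k * (d * inverse h)" by simp
  hence "fps_nth (inverse h) n = fps_nth (1 - fps_X ^ k * (d * inverse h)) n"
    by (rule arg_cong)
  also have "\<dots> = fps_nth 1 n"
    using assms k by (auto simp: fps_X_power_mult_nth)
  finally show ?thesis using True by (simp add: h_def)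
next
  case False
  thus ?thesis by (simp only: if_False)
qed

lemma has_prod_partition_gf:
  "(\<lambda>k. if k \<in> {1..} - E then inverse ((1 - fps_X ^ k) ^ g k) else 1) has_prod partition_gf E g"
proof -
  define c :: "nat \<Rightarrow> real fps" where
    "c = (\<lambda>k. if k \<in> {1..} - E then inverse ((1 - fps_X ^ k) ^ g k) else 1)"
  have c: "fps_nth (c k) n = fps_nth 1 n" if "n < k \<or> n = 0" for k n
    using partition_factor_nth[OF that] unfolding c_def by simp
  define P where "P = (\<lambda>N. \<Prod>i\<le>N. c i)"
  have step: "fps_nth (P (Suc N)) n = fps_nth (P N) n" if "n \<le> N" for N n
  proof -
    have "fps_nth (P (Suc N)) n = (\<Sum>i=0..n. fps_nth (P N) i * fps_nth (c (Suc N)) (n - i))"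
      by (simp add: P_def fps_mult_nth)
    also have "\<dots> = (\<Sum>i=0..n. fps_nth (P N) i * fps_nth 1 (n - i))"
      using that by (intro sum.cong refl arg_cong2[where f = "(*)"] c) auto
    also have "\<dots> = fps_nth (P N * 1) n" by (simp only: fps_mult_nth)
    finally show ?thesis by simp
  qed
  have stable: "fps_nth (P N) n = fps_nth (P n) n" if "n \<le> N" for N n
    using that by (induction N rule: dec_induct) (auto simp: step)
  define L where "L = Abs_fps (\<lambda>n. fps_nth (P n) n)"
  have "P \<longlonglongrightarrow> L"
    unfolding tendsto_fps_iff
  proof
    fix n
    have "fps_nth (P N) n = fps_nth L n" if "n \<le> N" for N
      using stable[OF that] by (simp only: L_def fps_nth_Abs_fps)
    thus "\<forall>\<^sub>F N in sequentially. fps_nth (P N) n = fps_nth L n"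
      by (rule eventually_sequentiallyI)
  qed
  moreover have "fps_nth L 0 = 1"
    using c[of 0 0] by (simp add: L_def P_def)
  hence "L \<noteq> 0" by auto
  ultimately have "c has_prod L"
    by (simp add: has_prod_def raw_has_prod_def P_def)
  moreover from this have "partition_gf E g = L"
    unfolding partition_gf_def c_def by (rule has_prod_unique[symmetric])
  ultimately show ?thesis by (simp add: c_def)
qed

end

theory Submission
  imports Defs
begin

text \<open>
  As \<open>l\<close> grows, the \<open>n\<close>-th coefficient is, up to constants depending on \<open>n\<close> only, the power
  with exponent \<open>\<Phi> l\<close> of the largest product of parts of a partition of \<open>n\<close>. This
  maximum is \<open>3\<^sup>a\<close>, \<open>4\<cdot>3\<^sup>a\<^sup>-\<^sup>1\<close>, \<open>2\<cdot>3\<^sup>a\<close> for \<open>n = 3a, 3a+1, 3a+2\<close>, and the sign of \<open>\<Delta>\<close> follows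
  from \<open>3 \<cdot> 3 > 2 \<cdot> 4\<close> and \<open>4 \<cdot> 4 < 3 \<cdot> 6\<close>. Both bounds come by induction on \<open>n\<close> from
  the recurrence given by the logarithmic derivative of the product, with constants
  uniform in the weights.
\<close>

unbundle no vec_syntax
unbundle fps_syntax

section \<open>Largest product of the parts of a partition\<close>

text \<open>The recursion splits off a part 3. It starts only above 4 because 1 is exceptional: the
  value at 4 is 4, not 3 times the value at 1.\<close>

fun max_prod :: "nat \<Rightarrow> nat" where
  "max_prod 0 = 1"
| "max_prod (Suc 0) = 1"
| "max_prod (Suc (Suc 0)) = 2"
| "max_prod (Suc (Suc (Suc 0))) = 3"
| "max_prod (Suc (Suc (Suc (Suc 0)))) = 4"
| "max_prod (Suc (Suc (Suc (Suc (Suc n))))) = 3 * max_prod (Suc (Suc n))"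

lemma max_prod_pos: "max_prod n > 0"
  by (induction n rule: max_prod.induct) auto

lemma max_prod_add3: "n \<noteq> 1 \<Longrightarrow> max_prod (n + 3) = 3 * max_prod n"
  by (cases n rule: max_prod.cases) (auto simp: numeral_eq_Suc)

text \<open>A part d \<ge> 5 may be replaced by 3 and d - 3 without lowering the product. This
  reduces the claim to d \<le> 4, where induction along the recursion for m suffices.\<close>

lemma mult_max_prod_le:
  assumes "d \<ge> 1"
  shows "d * max_prod m \<le> max_prod (m + d)"
  using assms
proof (induction d rule: less_induct)
  case (less d)
  show ?case
  proof (cases "d \<le> 4")
    case True
    with less.prems have "d \<in> {1, 2, 3, 4}" by auto
    thus ?thesis
      by (induction m rule: max_prod.induct) (auto simp: numeral_eq_Suc)
  next
    case False
    have "d * max_prod m \<le> 3 * ((d - 3) * max_prod m)"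
      unfolding mult.assoc[symmetric] using False by (intro mult_right_mono) linarith+
    also have "\<dots> \<le> 3 * max_prod (m + (d - 3))"
      using False by (intro mult_left_mono less.IH) auto
    \<comment> \<open>Here m + (d - 3) \<ge> 2, so the exceptional argument 1 does not
      occur.\<close>
    also have "\<dots> = max_prod (m + (d - 3) + 3)"
      using False by (intro max_prod_add3[symmetric]) auto
    finally show ?thesis using False by simp
  qed
qed

text \<open>The residue class 1 is written as 3 * a + 4, since the value at 1 does not fit the
  pattern.\<close>

lemma max_prod_3_mult:
  "max_prod (3 * a) = 3 ^ a" "max_prod (3 * a + 2) = 2 * 3 ^ a" "max_prod (3 * a + 4) = 4 * 3 ^ a"
proof -
  have "max_prod (3 * a) = 3 ^ a \<and> max_prod (3 * a + 2) = 2 * 3 ^ a \<and> max_prod (3 * a + 4) = 4 * 3 ^ a"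
  proof (induction a)
    case (Suc a)
    have eq: "3 * Suc a = 3 * a + 3" "3 * Suc a + 2 = (3 * a + 2) + 3"
      "3 * Suc a + 4 = (3 * a + 4) + 3" by auto
    have "3 * a \<noteq> 1" "3 * a + 2 \<noteq> 1" "3 * a + 4 \<noteq> 1" by presburger+
    from this[THEN max_prod_add3] show ?case
      unfolding eq using Suc by (simp del: add_2_eq_Suc')
  qed (simp add: numeral_eq_Suc)
  thus "max_prod (3 * a) = 3 ^ a" "max_prod (3 * a + 2) = 2 * 3 ^ a"
    "max_prod (3 * a + 4) = 4 * 3 ^ a" by auto
qed

section \<open>Logarithmic derivative of the product and the recurrence for its coefficients\<close>

definition partition_factor :: "nat set \<Rightarrow> (nat \<Rightarrow> nat) \<Rightarrow> nat \<Rightarrow> real fps" where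
  "partition_factor E g k =
     (if k \<in> {1..} - E then inverse ((1 - fps_X ^ k) ^ g k) else 1)"

definition log_factor :: "nat set \<Rightarrow> (nat \<Rightarrow> nat) \<Rightarrow> nat \<Rightarrow> real fps" where
  "log_factor E g k =
     Abs_fps (\<lambda>j. if j > 0 \<and> k \<in> {1..} - E \<and> k dvd j then real (k * g k) else 0)"

text \<open>For j \<ge> 1 this is the coefficient of q^j in q times the logarithmic derivative of
  the whole product; 0 does not divide such j, so \<open>g 0\<close> never enters.\<close>

definition weighted_divisor_sum :: "nat set \<Rightarrow> (nat \<Rightarrow> nat) \<Rightarrow> nat \<Rightarrow> nat" where
  "weighted_divisor_sum E g j = (\<Sum>d | d dvd j \<and> d \<notin> E. d * g d)"

text \<open>With h = 1 - q^k and c the factor, differentiate h^g(k) * c = 1. Denominators are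
  avoided: the identity is multiplied by h and h^g(k), which cancel at the end.\<close>

lemma deriv_partition_factor:
  "fps_X * fps_deriv (partition_factor E g k) = partition_factor E g k * log_factor E g k"
proof (cases "k \<in> {1..} - E")
  case False
  hence "log_factor E g k = 0" by (auto simp: log_factor_def fps_eq_iff)
  with False show ?thesis by (auto simp: partition_factor_def)
next
  case True
  hence k: "k > 0" "k \<notin> E" by auto
  define h :: "real fps" where "h = 1 - fps_X ^ k"
  define c where "c = inverse (h ^ g k)"
  have h0: "h $ 0 = 1" using k by (simp add: h_def)
  hence "h \<noteq> 0" by auto
  have "(h ^ g k) $ 0 = 1" using h0 by (simp add: fps_power_zeroth)
  hence hc: "h ^ g k * c = 1" unfolding c_def by (intro inverse_mult_eq_1') simp
  \<comment> \<open>The geometric series telescopes under multiplication by h, leaving only its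
    first term.\<close>
  have hL: "h * log_factor E g k = of_nat (k * g k) * fps_X ^ k"
  proof (rule fps_ext)
    fix j
    have "j - k > 0 \<and> k dvd j - k \<longleftrightarrow> j > k \<and> k dvd j" if "j \<ge> k"
      using that by (auto simp: dvd_minus_self)
    thus "(h * log_factor E g k) $ j = (of_nat (k * g k) * fps_X ^ k) $ j"
      using k by (auto simp: h_def log_factor_def left_diff_distrib fps_X_power_mult_nth
          fps_X_power_mult_right_nth dest: dvd_imp_le simp del: of_nat_mult)
  qed
  have "fps_X * fps_deriv h = - (of_nat k * (fps_X * fps_X ^ (k - 1)))"
    by (simp add: h_def fps_deriv_power fps_of_nat)
  hence Xh: "fps_X * fps_deriv h = - (of_nat k * fps_X ^ k)"
    using k by (simp flip: power_Suc)
  have Xhg: "h * (fps_X * fps_deriv (h ^ g k)) = - (h ^ g k * (of_nat (k * g k) * fps_X ^ k))"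
  proof (cases "g k")
    case (Suc m)
    have "fps_deriv (h ^ g k) = of_nat (g k) * fps_deriv h * h ^ m"
      unfolding fps_deriv_power' by (simp add: Suc)
    hence "h * (fps_X * fps_deriv (h ^ g k)) = of_nat (g k) * (h * h ^ m) * (fps_X * fps_deriv h)"
      by (simp only: mult_ac)
    also have "h * h ^ m = h ^ g k" by (simp add: Suc)
    finally have "h * (fps_X * fps_deriv (h ^ g k)) =
        of_nat (g k) * h ^ g k * (fps_X * fps_deriv h)" .
    thus ?thesis unfolding Xh by (simp add: algebra_simps)
  qed simp
  have "fps_deriv (h ^ g k * c) = 0" unfolding hc by simp
  hence D: "h ^ g k * fps_deriv c = - (fps_deriv (h ^ g k) * c)"
    by (simp add: add_eq_0_iff)
  have "h * (h ^ g k * (fps_X * fps_deriv c)) = h * fps_X * (h ^ g k * fps_deriv c)"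
    by (simp add: algebra_simps)
  also have "\<dots> = - (h * (fps_X * fps_deriv (h ^ g k))) * c"
    unfolding D by (simp add: algebra_simps)
  also have "\<dots> = h * (h ^ g k * (c * log_factor E g k))"
    unfolding Xhg hL[symmetric] by (simp add: algebra_simps)
  finally have "fps_X * fps_deriv c = c * log_factor E g k"
    using \<open>h \<noteq> 0\<close> by simp
  thus ?thesis using k by (simp add: partition_factor_def c_def h_def)
qed

lemma deriv_prod_partition_factor:
  "fps_X * fps_deriv (\<Prod>k\<le>N. partition_factor E g k) =
     (\<Prod>k\<le>N. partition_factor E g k) * (\<Sum>k\<le>N. log_factor E g k)"
proof (induction N)
  case (Suc N)
  define P where "P = (\<Prod>k\<le>N. partition_factor E g k)"
  have "fps_X * fps_deriv (P * partition_factor E g (Suc N)) =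
      partition_factor E g (Suc N) * (fps_X * fps_deriv P) +
      P * (fps_X * fps_deriv (partition_factor E g (Suc N)))"
    by (simp add: algebra_simps)
  also have "\<dots> = P * partition_factor E g (Suc N) * (\<Sum>k\<le>Suc N. log_factor E g k)"
    unfolding deriv_partition_factor Suc[folded P_def] by (simp add: algebra_simps)
  finally show ?case by (simp add: P_def)
qed (simp add: deriv_partition_factor)

text \<open>The series with index k > j has no coefficient at j, so truncating at N \<ge> j loses
  nothing.\<close>

lemma nth_sum_log_factor:
  assumes "j \<le> N"
  shows "(\<Sum>k\<le>N. log_factor E g k) $ j =
    (if j = 0 then 0 else real (weighted_divisor_sum E g j))"
proof (cases "j = 0")
  case False
  have "(\<Sum>k\<le>N. log_factor E g k $ j) =
      (\<Sum>k\<le>N. if k dvd j \<and> k \<notin> E then real (k * g k) else 0)"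
    using False by (intro sum.cong refl) (auto simp: log_factor_def not_less_eq_eq)
  also have "\<dots> = (\<Sum>k | k dvd j \<and> k \<notin> E. real (k * g k))"
    using assms False by (intro sum.mono_neutral_cong_right) (auto dest: dvd_imp_le)
  finally show ?thesis using False by (simp add: weighted_divisor_sum_def fps_sum_nth)
qed (simp add: fps_sum_nth log_factor_def)

lemma prod_partition_factor_tendsto:
  "(\<lambda>N. \<Prod>k\<le>N. partition_factor E g k) \<longlonglongrightarrow> partition_gf E g"
  using has_prod_partition_gf[of E g] unfolding partition_factor_def
  by (rule has_prod_imp_tendsto)

lemma partition_gf_nth_0: "partition_gf E g $ 0 = 1"
proof -
  have "partition_factor E g k $ 0 = 1" for k
    unfolding partition_factor_def by (subst partition_factor_nth) auto
  hence "(\<Prod>k\<le>N. partition_factor E g k) $ 0 = 1" for N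
    by (induction N) auto
  moreover have "\<forall>\<^sub>F N in sequentially. (\<Prod>k\<le>N. partition_factor E g k) $ 0 = partition_gf E g $ 0"
    using prod_partition_factor_tendsto unfolding tendsto_fps_iff by blast
  ultimately show ?thesis by (simp add: eventually_const_iff)
qed

text \<open>Coefficients of q^n are compared in the identity for a partial product that agrees with
  the infinite product up to order n.\<close>

lemma partition_gf_recurrence:
  "real n * partition_gf E g $ n =
     (\<Sum>i<n. partition_gf E g $ i * real (weighted_divisor_sum E g (n - i)))"
proof -
  let ?P = "\<lambda>N. \<Prod>k\<le>N. partition_factor E g k"
  \<comment> \<open>Each coefficient is eventually constant, and only finitely many occur, so one N
    serves them all.\<close>
  have "\<forall>\<^sub>F N in sequentially. \<forall>i\<in>{..n}. ?P N $ i = partition_gf E g $ i"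
    using prod_partition_factor_tendsto[of E g] unfolding tendsto_fps_iff
    by (intro eventually_ball_finite) auto
  moreover have "\<forall>\<^sub>F N in sequentially. N \<ge> n" by (rule eventually_ge_at_top)
  ultimately have "\<exists>N. (\<forall>i\<in>{..n}. ?P N $ i = partition_gf E g $ i) \<and> N \<ge> n"
    by (intro eventually_happens'[OF sequentially_bot] eventually_conj)
  then obtain N where N: "\<And>i. i \<le> n \<Longrightarrow> ?P N $ i = partition_gf E g $ i" "N \<ge> n"
    by blast
  have "real n * partition_gf E g $ n = (fps_X * fps_deriv (?P N)) $ n"
    using N by (cases n) auto
  also have "\<dots> = (\<Sum>i=0..n. ?P N $ i * (\<Sum>k\<le>N. log_factor E g k) $ (n - i))"
    unfolding deriv_prod_partition_factor by (simp add: fps_mult_nth)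
  also have "\<dots> = (\<Sum>i=0..n. partition_gf E g $ i *
      (if i = n then 0 else real (weighted_divisor_sum E g (n - i))))"
    using N by (intro sum.cong refl) (auto simp: nth_sum_log_factor)
  also have "\<dots> = (\<Sum>i<n. partition_gf E g $ i * real (weighted_divisor_sum E g (n - i)))"
    by (intro sum.mono_neutral_cong_right) auto
  finally show ?thesis .
qed

section \<open>Bounds on the coefficients, uniform in the weights\<close>

lemma partition_gf_nonneg: "partition_gf E g $ n \<ge> 0"
proof (induction n rule: less_induct)
  case (less n)
  show ?case
  proof (cases "n = 0")
    case False
    have "real n * partition_gf E g $ n \<ge> 0"
      unfolding partition_gf_recurrence by (intro sum_nonneg mult_nonneg_nonneg less.IH) auto
    thus ?thesis using False by (simp add: zero_le_mult_iff)
  qed (simp add: partition_gf_nth_0)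
qed

text \<open>All terms of the recurrence are nonnegative; only the summand i = m is kept, and in its
  divisor sum only d.\<close>

lemma partition_gf_ge_mult:
  assumes "d \<ge> 1" and "d \<notin> E"
  shows "real (d * g d) * partition_gf E g $ m \<le> real (m + d) * partition_gf E g $ (m + d)"
proof -
  have "d * g d \<le> weighted_divisor_sum E g d"
    unfolding weighted_divisor_sum_def using assms by (intro member_le_sum) auto
  hence "real (d * g d) * partition_gf E g $ m
      \<le> partition_gf E g $ m * real (weighted_divisor_sum E g (m + d - m))"
    by (simp add: mult.commute mult_left_mono partition_gf_nonneg del: of_nat_mult)
  also have "\<dots> \<le> (\<Sum>i<m+d. partition_gf E g $ i * real (weighted_divisor_sum E g (m + d - i)))"
    using assms by (intro member_le_sum mult_nonneg_nonneg partition_gf_nonneg) auto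
  finally show ?thesis unfolding partition_gf_recurrence .
qed

text \<open>Removing parts 3 from m in the residue classes 0 and 2 ends at 0 or 2, so the weights at
  2 and 3 suffice. The factorial absorbs the factors on the left of the recurrence.\<close>

lemma partition_gf_lower:
  assumes "2 \<notin> E" and "3 \<notin> E" and "2 powr x \<le> real (g 2)" and "3 powr x \<le> real (g 3)"
    and "m mod 3 \<noteq> 1"
  shows "real (max_prod m) powr x / fact m \<le> partition_gf E g $ m"
  using assms(5)
proof (induction m rule: less_induct)
  case (less m)
  consider "m = 0" | "m = 2" | "m \<ge> 3"
    using less.prems by (cases "m = 1") (auto, linarith)
  thus ?case
  proof cases
    case 1
    thus ?thesis by (simp add: partition_gf_nth_0)
  next
    case 2
    have "2 powr x \<le> partition_gf E g $ 2"
      using partition_gf_ge_mult[of 2 E g 0] assms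
      by (simp add: partition_gf_nth_0 del: add_2_eq_Suc add_2_eq_Suc')
    moreover have "2 powr x / 2 \<le> 2 powr x" by simp
    ultimately have "2 powr x / 2 \<le> partition_gf E g $ 2" by linarith
    moreover have "max_prod 2 = 2" by (simp add: numeral_eq_Suc)
    ultimately show ?thesis using 2 by simp
  next
    case 3
    define k where "k = m - 3"
    have m: "m = k + 3" using 3 by (simp add: k_def)
    have k: "k mod 3 \<noteq> 1" using less.prems by (simp add: m)
    hence k1: "k \<noteq> 1" by auto
    have "real (max_prod m) powr x / fact k = 3 powr x * (real (max_prod k) powr x / fact k)"
      unfolding m max_prod_add3[OF k1] by (simp add: powr_mult)
    also have "\<dots> \<le> real (g 3) * partition_gf E g $ k"
      using assms(4) less.IH[of k] k by (intro mult_mono) (auto simp: m)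
    also have "\<dots> \<le> real (3 * g 3) * partition_gf E g $ k"
      by (intro mult_right_mono partition_gf_nonneg) auto
    also have "\<dots> \<le> real m * partition_gf E g $ m"
      unfolding m using assms by (intro partition_gf_ge_mult) auto
    finally have "real (max_prod m) powr x / (real m * fact k) \<le> partition_gf E g $ m"
      using 3 by (simp add: field_simps)
    \<comment> \<open>Since k = m - 3, this is (m - 3)! \<le> (m - 1)! multiplied by m.\<close>
    moreover have "real m * fact k \<le> fact m"
    proof -
      have "m * fact k \<le> m * fact (m - 1)"
        by (intro mult_left_mono fact_mono) (auto simp: m)
      also have "\<dots> = fact m" using 3 by (simp add: fact_reduce)
      finally show ?thesis by (metis of_nat_fact of_nat_le_iff of_nat_mult)
    qed
    hence "real (max_prod m) powr x / fact m \<le> real (max_prod m) powr x / (real m * fact k)"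
      using 3 by (intro divide_left_mono) auto
    ultimately show ?thesis by linarith
  qed
qed

text \<open>There are at most j divisors, each contributing at most j * j powr x.\<close>

lemma weighted_divisor_sum_le:
  assumes "x \<ge> 0" and "\<And>k. k \<ge> 1 \<Longrightarrow> real (g k) \<le> real k powr x" and "j \<ge> 1"
  shows "real (weighted_divisor_sum E g j) \<le> real j ^ 2 * real j powr x"
proof -
  have sub: "{d. d dvd j \<and> d \<notin> E} \<subseteq> {1..j}"
    using assms(3) by (auto dest: dvd_imp_le simp: Suc_le_eq intro!: Nat.gr0I)
  have "real (weighted_divisor_sum E g j) = (\<Sum>d | d dvd j \<and> d \<notin> E. real d * real (g d))"
    by (simp add: weighted_divisor_sum_def)
  also have "\<dots> \<le> (\<Sum>d | d dvd j \<and> d \<notin> E. real j * real j powr x)"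
  proof (intro sum_mono mult_mono)
    fix d assume "d \<in> {d. d dvd j \<and> d \<notin> E}"
    hence d: "1 \<le> d" "d \<le> j" using sub by auto
    show "real d \<le> real j" using d by simp
    show "real (g d) \<le> real j powr x"
      using assms(2)[of d] powr_mono2[of x "real d" "real j"] d assms(1) by simp
  qed auto
  also have "\<dots> = real (card {d. d dvd j \<and> d \<notin> E}) * (real j * real j powr x)" by simp
  also have "\<dots> \<le> real j * (real j * real j powr x)"
    using card_mono[OF _ sub] by (intro mult_right_mono) auto
  finally show ?thesis by (simp add: power2_eq_square)
qed

text \<open>The n summands of the recurrence cancel the factor n on its left. Each carries (n -
  1)!^2 * n^2 = n!^2, and \<open>mult_max_prod_le\<close> with d = n - i bounds its powers.\<close>

lemma partition_gf_upper:
  assumes "x \<ge> 0" and "\<And>k. k \<ge> 1 \<Longrightarrow> real (g k) \<le> real k powr x"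
  shows "partition_gf E g $ n \<le> fact n ^ 2 * real (max_prod n) powr x"
proof (induction n rule: less_induct)
  case (less n)
  show ?case
  proof (cases "n = 0")
    case False
    have "real n * partition_gf E g $ n \<le>
        (\<Sum>i<n. (fact (n - 1) ^ 2 * real (max_prod i) powr x) * (real n ^ 2 * real (n - i) powr x))"
      unfolding partition_gf_recurrence
    proof (intro sum_mono mult_mono)
      fix i assume "i \<in> {..<n}"
      hence i: "i < n" by simp
      have "fact i ^ 2 * real (max_prod i) powr x \<le> fact (n - 1) ^ 2 * real (max_prod i) powr x"
        using i by (intro mult_right_mono power_mono fact_mono) auto
      thus "partition_gf E g $ i \<le> fact (n - 1) ^ 2 * real (max_prod i) powr x"
        using less.IH[OF i] by linarith
      have "real (n - i) ^ 2 * real (n - i) powr x \<le> real n ^ 2 * real (n - i) powr x"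
        by (intro mult_right_mono power_mono) auto
      thus "real (weighted_divisor_sum E g (n - i)) \<le> real n ^ 2 * real (n - i) powr x"
        using weighted_divisor_sum_le[OF assms, of "n - i" E] i by linarith
    qed auto
    also have "\<dots> \<le> (\<Sum>i<n. fact n ^ 2 * real (max_prod n) powr x)"
    proof (rule sum_mono)
      fix i assume "i \<in> {..<n}"
      hence "(n - i) * max_prod i \<le> max_prod n"
        using mult_max_prod_le[of "n - i" i] by simp
      hence "real ((n - i) * max_prod i) powr x \<le> real (max_prod n) powr x"
        using assms(1) by (intro powr_mono2) (auto simp del: of_nat_mult)
      hence "fact n ^ 2 * (real (n - i) powr x * real (max_prod i) powr x)
          \<le> fact n ^ 2 * real (max_prod n) powr x"
        by (simp add: powr_mult)
      thus "(fact (n - 1) ^ 2 * real (max_prod i) powr x) * (real n ^ 2 * real (n - i) powr x)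
          \<le> fact n ^ 2 * real (max_prod n) powr x"
        using False by (simp add: fact_reduce[of n] power_mult_distrib mult_ac)
    qed
    also have "\<dots> = real n * (fact n ^ 2 * real (max_prod n) powr x)" by simp
    finally show ?thesis using False by simp
  qed (simp add: partition_gf_nth_0)
qed

section \<open>Comparison of growth as l tends to infinity\<close>

text \<open>The ratio (b / a) powr \<Phi> l tends to infinity and outgrows the constant K /
  c.\<close>

lemma eventually_powr_less:
  fixes a b K c :: real
  assumes "filterlim \<Phi> at_top F" and "0 < a" and "a < b" and "c > 0"
  shows "\<forall>\<^sub>F l in F. K * a powr \<Phi> l < c * b powr \<Phi> l"
proof -
  have "filterlim (\<lambda>l. ln (b / a) * \<Phi> l) at_top F"
    using assms by (intro filterlim_tendsto_pos_mult_at_top[OF tendsto_const]) auto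
  hence "filterlim (\<lambda>l. exp (ln (b / a) * \<Phi> l)) at_top F"
    by (rule filterlim_compose[OF exp_at_top])
  hence "\<forall>\<^sub>F l in F. exp (ln (b / a) * \<Phi> l) > K / c"
    by (simp add: filterlim_at_top_dense)
  thus ?thesis
  proof eventually_elim
    case (elim l)
    have "K * a powr \<Phi> l < c * exp (ln (b / a) * \<Phi> l) * a powr \<Phi> l"
      using elim assms by (simp add: field_simps)
    also have "\<dots> = c * b powr \<Phi> l"
      using assms by (simp add: powr_def ln_div algebra_simps flip: exp_add)
    finally show ?case .
  qed
qed

text \<open>
  \<open>\<Psi>\<close> may exceed \<open>\<Phi>\<close> by at most \<open>B\<close>, which only changes the constant of the upper bound.
\<close>

lemma p_exc_bounds:
  assumes "admissible f" and "2 \<notin> E" and "3 \<notin> E"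
  obtains \<Phi> :: "nat \<Rightarrow> real" and C :: "nat \<Rightarrow> real"
  where "filterlim \<Phi> at_top sequentially"
    and "\<forall>\<^sub>F l in sequentially. \<forall>m. p_exc f E l m \<le> C m * real (max_prod m) powr \<Phi> l"
    and "\<forall>\<^sub>F l in sequentially. \<forall>m. m mod 3 \<noteq> 1 \<longrightarrow>
           real (max_prod m) powr \<Phi> l / fact m \<le> p_exc f E l m"
proof -
  from assms(1) obtain \<Phi> \<Psi> :: "nat \<Rightarrow> real" and B :: real where
    bnd: "\<forall>l\<ge>1. \<forall>n\<ge>1. real n powr \<Phi> l \<le> real (f l n) \<and> real (f l n) \<le> real n powr \<Psi> l"
    and B: "\<forall>l\<ge>1. 0 \<le> \<Psi> l - \<Phi> l \<and> \<Psi> l - \<Phi> l \<le> B"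
    and lim: "filterlim \<Phi> at_top sequentially"
    unfolding admissible_def by (elim conjE exE) (rule that)
  \<comment> \<open>This makes \<Psi> l nonnegative too, as the exponent in
    \<open>partition_gf_upper\<close> must be.\<close>
  have "\<forall>\<^sub>F l in sequentially. \<Phi> l \<ge> 0"
    using lim by (simp add: filterlim_at_top)
  hence ev: "\<forall>\<^sub>F l in sequentially. \<Phi> l \<ge> 0 \<and> l \<ge> 1"
    using eventually_ge_at_top by (rule eventually_conj)
  show thesis
  proof (rule that[OF lim])
    show "\<forall>\<^sub>F l in sequentially. \<forall>m. p_exc f E l m
        \<le> (fact m ^ 2 * real (max_prod m) powr B) * real (max_prod m) powr \<Phi> l"
      using ev
    proof eventually_elim
      case (elim l)
      show ?case
      proof
        fix m
        have M: "real (max_prod m) \<ge> 1" using max_prod_pos[of m] by linarith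
        have "p_exc f E l m \<le> fact m ^ 2 * real (max_prod m) powr \<Psi> l"
          unfolding p_exc_def using bnd B elim by (intro partition_gf_upper) auto
        also have "\<dots> \<le> fact m ^ 2 * real (max_prod m) powr (B + \<Phi> l)"
          using B elim M by (intro mult_left_mono powr_mono) (auto simp: diff_le_eq)
        finally show "p_exc f E l m
            \<le> (fact m ^ 2 * real (max_prod m) powr B) * real (max_prod m) powr \<Phi> l"
          by (simp add: powr_add mult_ac)
      qed
    qed
    show "\<forall>\<^sub>F l in sequentially. \<forall>m. m mod 3 \<noteq> 1 \<longrightarrow>
        real (max_prod m) powr \<Phi> l / fact m \<le> p_exc f E l m"
      using ev
    proof eventually_elim
      case (elim l)
      show ?case
        unfolding p_exc_def using elim assms bnd[rule_format, of l 2] bnd[rule_format, of l 3]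
        by (intro allI impI partition_gf_lower) auto
    qed
  qed
qed

lemma p_exc_nonneg: "p_exc f E l m \<ge> 0"
  unfolding p_exc_def by (rule partition_gf_nonneg)

text \<open>Both products are controlled by constants times powers with the same exponent \<Phi> l,
  so the strict inequality between the bases decides. Only s and t need the lower bound, hence the
  condition on their residues.\<close>

lemma p_exc_mult_less:
  assumes "admissible f" and "2 \<notin> E" and "3 \<notin> E"
    and "s mod 3 \<noteq> 1" and "t mod 3 \<noteq> 1"
    and "max_prod i * max_prod j < max_prod s * max_prod t"
  shows "\<forall>\<^sub>F l in sequentially. p_exc f E l i * p_exc f E l j < p_exc f E l s * p_exc f E l t"
proof -
  obtain \<Phi> C where lim: "filterlim \<Phi> at_top sequentially"
    and up: "\<forall>\<^sub>F l in sequentially. \<forall>m. p_exc f E l m \<le> C m * real (max_prod m) powr \<Phi> l"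
    and lo: "\<forall>\<^sub>F l in sequentially. \<forall>m. m mod 3 \<noteq> 1 \<longrightarrow>
           real (max_prod m) powr \<Phi> l / fact m \<le> p_exc f E l m"
    using p_exc_bounds[OF assms(1-3)] .
  have "\<forall>\<^sub>F l in sequentially. (C i * C j) * real (max_prod i * max_prod j) powr \<Phi> l
      < (1 / (fact s * fact t)) * real (max_prod s * max_prod t) powr \<Phi> l"
    using assms(6) max_prod_pos
    by (intro eventually_powr_less[OF lim]) (auto simp del: of_nat_mult)
  with up lo show ?thesis
  proof eventually_elim
    case (elim l)
    have "p_exc f E l i * p_exc f E l j
        \<le> (C i * real (max_prod i) powr \<Phi> l) * (C j * real (max_prod j) powr \<Phi> l)"
      using elim(1) by (intro mult_mono) (auto intro: p_exc_nonneg order_trans[OF p_exc_nonneg])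
    also have "\<dots> = (C i * C j) * real (max_prod i * max_prod j) powr \<Phi> l"
      by (simp add: powr_mult)
    also note elim(3)
    also have "(1 / (fact s * fact t)) * real (max_prod s * max_prod t) powr \<Phi> l =
        (real (max_prod s) powr \<Phi> l / fact s) * (real (max_prod t) powr \<Phi> l / fact t)"
      by (simp add: powr_mult)
    also have "\<dots> \<le> p_exc f E l s * p_exc f E l t"
      using elim(2) assms by (intro mult_mono) (auto intro: p_exc_nonneg)
    finally show ?case .
  qed
qed

section \<open>The sign of \<open>Delta\<close> by residue class modulo 3\<close>

theorem theorem2p1:
  fixes f :: "nat \<Rightarrow> nat \<Rightarrow> nat" and S E :: "nat set" and n :: nat
  assumes "admissible f"
    and "S \<subseteq> {1..}" and "E = {1..} - S"
    and "1 \<in> S" and "2 \<in> S" and "3 \<in> S"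
    and "n \<ge> 3" and "n mod 3 \<noteq> 2"
  shows "\<forall>\<^sub>F l in sequentially.
           (n mod 3 = 0 \<longrightarrow> Delta f E l n > 0) \<and> (n mod 3 = 1 \<longrightarrow> Delta f E l n < 0)"
proof -
  have E: "2 \<notin> E" "3 \<notin> E" using assms by auto
  \<comment> \<open>The shift by one writes n as 3 * a + 3 or 3 * a + 4, so that n - 1 and n + 1
    also match the closed forms.\<close>
  define a where "a = n div 3 - 1"
  consider "n = 3 * a + 3" "n mod 3 = 0" | "n = 3 * a + 4" "n mod 3 = 1"
  proof (cases "n mod 3 = 0")
    case True
    with assms(7) have "n = 3 * a + 3" unfolding a_def by presburger
    with True show thesis by (intro that(1))
  next
    case False
    with assms(7,8) have "n = 3 * a + 4" "n mod 3 = 1" unfolding a_def by presburger+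
    thus thesis by (rule that(2))
  qed
  thus ?thesis
  proof cases
    case 1
    have "n = 3 * Suc a" "n - 1 = 3 * a + 2" "n + 1 = 3 * a + 4" using 1(1) by simp_all
    hence "max_prod n = 3 * 3 ^ a" "max_prod (n - 1) = 2 * 3 ^ a" "max_prod (n + 1) = 4 * 3 ^ a"
      by (metis max_prod_3_mult power_Suc)+
    \<comment> \<open>Up to the common factor 9^a this is 8 < 9.\<close>
    hence "max_prod (n - 1) * max_prod (n + 1) < max_prod n * max_prod n" by simp
    from p_exc_mult_less[OF assms(1) E _ _ this] 1 show ?thesis
      by (simp add: Delta_def power2_eq_square)
  next
    case 2
    have n: "n = 3 * a + 4" "n - 1 = 3 * Suc a" "n + 1 = 3 * Suc a + 2" using 2(1) by simp_all
    hence "max_prod n = 4 * 3 ^ a" "max_prod (n - 1) = 3 * 3 ^ a"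
      "max_prod (n + 1) = 2 * (3 * 3 ^ a)"
      by (metis max_prod_3_mult power_Suc)+
    \<comment> \<open>Up to the common factor 9^a this is 16 < 18.\<close>
    hence *: "max_prod n * max_prod n < max_prod (n - 1) * max_prod (n + 1)" by simp
    have "(n - 1) mod 3 \<noteq> 1" "(n + 1) mod 3 \<noteq> 1" unfolding n(2,3) by presburger+
    from p_exc_mult_less[OF assms(1) E this *] 2 show ?thesis
      by (simp add: Delta_def power2_eq_square)
  qed
qed

end
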